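(* Let $G$ be a finite group, $\lambda$ a positive integer, and let $(S,T)$ be a $\lambda$-fold near-factorization of $G$, where one of the factors $S$ or $T$ is symmetric. Then the other factor is also symmetric.
   Context: For subsets $S,T$ of a finite group $G$ with identity $e$, and a positive integer $\lambda$, $(S,T)$ is a $\lambda$-fold near-factorization of $G$ if every non-identity element $g\in G$ can be written as $g=st$ with $s\in S$, $t\in T$ in exactly $\lambda$ ways, and $st\neq e$ for all $s\in S$, $t\in T$. A subset $A\subseteq G$ is symmetric if, for every $g\in G$, $g\in A$ if and only if $g^{-1}\in A$. *)

theory Defs
  imports "HOL-Algebra.Group"
begin

definition near_factorization ::
    "('a, 'b) monoid_scheme \<Rightarrow> nat \<Rightarrow> 'a set \<Rightarrow> 'a set \<Rightarrow> bool" where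
  "near_factorization G l S T \<longleftrightarrow>
     S \<subseteq> carrier G \<and> T \<subseteq> carrier G \<and>
     (\<forall>g \<in> carrier G - {\<one>\<^bsub>G\<^esub>}. card {(s, t). s \<in> S \<and> t \<in> T \<and> g = s \<otimes>\<^bsub>G\<^esub> t} = l) \<and>
     (\<forall>s \<in> S. \<forall>t \<in> T. s \<otimes>\<^bsub>G\<^esub> t \<noteq> \<one>\<^bsub>G\<^esub>)"

definition symmetric_subset :: "('a, 'b) monoid_scheme \<Rightarrow> 'a set \<Rightarrow> bool" where
  "symmetric_subset G A \<longleftrightarrow>
     A \<subseteq> carrier G \<and> (\<forall>g \<in> carrier G. g \<in> A \<longleftrightarrow> inv\<^bsub>G\<^esub> g \<in> A)"

end

theory Submission
  imports Defs
begin

text \<open>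
  In the group ring, identify sets with the sums of their elements and let \<open>*\<close> denote inversion of
  a set.  If \<open>S\<^sup>* = S\<close>, then \<open>S T = l (G - e)\<close> yields \<open>T\<^sup>* S = l (G - e)\<close>, and evaluating \<open>T\<^sup>* S T\<close>
  in two ways gives \<open>l (|T| G - T\<^sup>*) = l (|T| G - T)\<close>, so \<open>T\<^sup>* = T\<close>.  The other case follows because
  \<open>(T\<^sup>*, S\<^sup>*)\<close> is again a near-factorization.
\<close>

context group
begin

lemma symmetric_subset_image_inv:
  assumes "symmetric_subset G A"
  shows "m_inv G ` A = A"
proof (intro subset_antisym subsetI)
  fix x assume "x \<in> m_inv G ` A"
  then show "x \<in> A"
    using assms unfolding symmetric_subset_def by blast
next
  fix x assume "x \<in> A"
  then have "inv x \<in> A" "inv (inv x) = x"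
    using assms unfolding symmetric_subset_def by (blast, blast intro: inv_inv)
  then show "x \<in> m_inv G ` A"
    by (metis imageI)
qed

text \<open>Inversion is an involution: inverting the set of inverses gives \<open>A\<close> back,
  but by symmetry it also leaves that set unchanged, so the two sets coincide.\<close>

lemma symmetric_subset_if_image_inv:
  assumes "A \<subseteq> carrier G" and "symmetric_subset G (m_inv G ` A)"
  shows "symmetric_subset G A"
proof -
  have "m_inv G ` m_inv G ` A = A"
    using assms(1) by (simp add: image_image subset_iff cong: image_cong_simp)
  then show ?thesis
    using symmetric_subset_image_inv[OF assms(2)] assms(2) by simp
qed

text \<open>Merges both defining conditions into one formula, so that counts can be evaluated
  without knowing whether the element is the identity.\<close>

lemma near_factorization_card:
  assumes "near_factorization G l S T" and "g \<in> carrier G"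
  shows "card {(s, t). s \<in> S \<and> t \<in> T \<and> g = s \<otimes> t} = (if g = \<one> then 0 else l)"
proof (cases "g = \<one>")
  case True
  then have empty: "{(s, t). s \<in> S \<and> t \<in> T \<and> g = s \<otimes> t} = {}"
    using assms(1) unfolding near_factorization_def by fastforce
  show ?thesis
    unfolding empty by (simp add: True)
next
  case False
  then show ?thesis
    using assms unfolding near_factorization_def by auto
qed

text \<open>Inversion reverses products, so factorizations of \<open>inv g\<close> over
  \<open>S\<close> and \<open>T\<close> correspond to factorizations of \<open>g\<close> over the
  inverse sets in the opposite order.\<close>

lemma near_factorization_inv:
  assumes nf: "near_factorization G l S T"
  shows "near_factorization G l (m_inv G ` T) (m_inv G ` S)"
proof -
  have sub: "S \<subseteq> carrier G" "T \<subseteq> carrier G"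
    using nf unfolding near_factorization_def by auto
  have "card {(t, s). t \<in> m_inv G ` T \<and> s \<in> m_inv G ` S \<and> g = t \<otimes> s} = l"
    if g: "g \<in> carrier G - {\<one>}" for g
  proof -
    have "bij_betw (\<lambda>(s, t). (inv t, inv s))
        {(s, t). s \<in> S \<and> t \<in> T \<and> inv g = s \<otimes> t}
        {(t, s). t \<in> m_inv G ` T \<and> s \<in> m_inv G ` S \<and> g = t \<otimes> s}"
    proof (rule bij_betw_byWitness[where f' = "\<lambda>(t, s). (inv s, inv t)"])
      show "(\<lambda>(s, t). (inv t, inv s)) ` {(s, t). s \<in> S \<and> t \<in> T \<and> inv g = s \<otimes> t}
          \<subseteq> {(t, s). t \<in> m_inv G ` T \<and> s \<in> m_inv G ` S \<and> g = t \<otimes> s}"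
        using sub g by clarsimp (metis DiffD1 inv_inv inv_mult_group subsetD)
    qed (use sub g in \<open>auto simp: subset_iff inv_mult_group\<close>)
    then have "card {(t, s). t \<in> m_inv G ` T \<and> s \<in> m_inv G ` S \<and> g = t \<otimes> s}
        = card {(s, t). s \<in> S \<and> t \<in> T \<and> inv g = s \<otimes> t}"
      by (simp add: bij_betw_same_card)
    also have "\<dots> = l"
      using near_factorization_card[OF nf, of "inv g"] g by auto
    finally show ?thesis .
  qed
  moreover have "inv t \<otimes> inv s \<noteq> \<one>" if "s \<in> S" "t \<in> T" for s t
  proof -
    have "s \<otimes> t \<noteq> \<one>"
      using nf that unfolding near_factorization_def by blast
    then show ?thesis
      using that sub by (metis inv_eq_1_iff inv_mult_group m_closed subsetD)
  qed
  ultimately show ?thesis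
    using sub unfolding near_factorization_def by auto
qed

text \<open>Each \<open>a\<close> in \<open>T\<close> contributes \<open>l\<close>, except that
  \<open>a = inv h\<close> contributes nothing because \<open>a \<otimes> h\<close> is then the
  identity; the conditional term makes up for this loss. Hence the sum detects whether
  \<open>inv h\<close> lies in \<open>T\<close>. The additive form avoids truncated
  subtraction.\<close>

lemma near_factorization_sum_translate:
  assumes nf: "near_factorization G l S T" and "finite T" and h: "h \<in> carrier G"
  shows "(\<Sum>a\<in>T. card {(s, t). s \<in> S \<and> t \<in> T \<and> a \<otimes> h = s \<otimes> t})
      + (if inv h \<in> T then l else 0) = l * card T"
proof -
  have sub: "T \<subseteq> carrier G"
    using nf unfolding near_factorization_def by auto
  have "card {(s, t). s \<in> S \<and> t \<in> T \<and> a \<otimes> h = s \<otimes> t} + (if inv h = a then l else 0) = l"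
    if "a \<in> T" for a
  proof -
    have a: "a \<in> carrier G"
      using that sub by blast
    have "a \<otimes> h = \<one> \<longleftrightarrow> inv h = a"
      using a h inv_equality l_inv by blast
    then show ?thesis
      using near_factorization_card[OF nf, of "a \<otimes> h"] a h by simp
  qed
  then have "(\<Sum>a\<in>T. card {(s, t). s \<in> S \<and> t \<in> T \<and> a \<otimes> h = s \<otimes> t}
      + (if inv h = a then l else 0)) = l * card T"
    by simp
  then show ?thesis
    using \<open>finite T\<close> by (simp add: sum.distrib)
qed

lemma near_factorization_symmetric:
  assumes fin: "finite (carrier G)" and "l > 0"
    and nf: "near_factorization G l S T" and S: "symmetric_subset G S"
  shows "symmetric_subset G T"
proof -
  have sub: "S \<subseteq> carrier G" "T \<subseteq> carrier G"
    using nf unfolding near_factorization_def by auto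
  have finST: "finite S" "finite T"
    using sub fin finite_subset by auto
  have fib: "finite {(s, t). s \<in> S \<and> t \<in> T \<and> x = s \<otimes> t}" for x
    by (rule finite_subset[of _ "S \<times> T"]) (use finST in auto)
  have invS: "inv s \<in> S" if "s \<in> S" for s
    using that S unfolding symmetric_subset_def by blast
  have "g \<in> T \<longleftrightarrow> inv g \<in> T" if g: "g \<in> carrier G" for g
  proof -
    \<comment> \<open>The triples with \<open>inv a \<otimes> s \<otimes> t = h\<close>: their
      number is the coefficient of \<open>h\<close> in the group ring product of the inverses of
      \<open>T\<close> with \<open>S\<close> and \<open>T\<close>.\<close>
    define A where "A h = (SIGMA a:T. {(s, t). s \<in> S \<and> t \<in> T \<and> a \<otimes> h = s \<otimes> t})" for h
    have cardA: "card (A h) = (\<Sum>a\<in>T. card {(s, t). s \<in> S \<and> t \<in> T \<and> a \<otimes> h = s \<otimes> t})" for h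
      unfolding A_def using finST fib by (simp add: card_SigmaI)
    text \<open>\<open>a g = s t\<close> iff \<open>t g\<^sup>-\<^sup>1 = s\<^sup>-\<^sup>1 a\<close>: both say that \<open>a\<^sup>-\<^sup>1 s t = g\<close>.\<close>
    have swap: "t \<otimes> inv h = inv s \<otimes> a"
      if "a \<otimes> h = s \<otimes> t" "s \<in> S" "a \<in> T" "t \<in> T" "h \<in> carrier G" for a s t h
    proof -
      have c: "a \<in> carrier G" "s \<in> carrier G" "t \<in> carrier G"
        using that sub by auto
      have "t = inv s \<otimes> (a \<otimes> h)"
        using that c by (simp add: m_assoc[symmetric])
      then have "t \<otimes> inv h = inv s \<otimes> (a \<otimes> h) \<otimes> inv h"
        by simp
      also have "\<dots> = inv s \<otimes> a"
        using that(5) c by (simp add: m_assoc)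
      finally show ?thesis .
    qed
    \<comment> \<open>Inverting \<open>inv a \<otimes> s \<otimes> t\<close> exchanges
      \<open>a\<close> with \<open>t\<close> and replaces \<open>s\<close> by \<open>inv s\<close>,
      which stays in \<open>S\<close> by symmetry. The same formula undoes the exchange, so it
      serves as its own witness.\<close>
    have "bij_betw (\<lambda>(a, s, t). (t, inv s, a)) (A g) (A (inv g))"
    proof (rule bij_betw_byWitness[where f' = "\<lambda>(a, s, t). (t, inv s, a)"])
      show "(\<lambda>(a, s, t). (t, inv s, a)) ` A g \<subseteq> A (inv g)"
        using g swap invS by (auto simp: A_def)
      show "(\<lambda>(a, s, t). (t, inv s, a)) ` A (inv g) \<subseteq> A g"
        using g swap[of _ "inv g"] invS by (auto simp: A_def)
    qed (use sub in \<open>auto simp: A_def subset_iff\<close>)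
    then have "card (A g) = card (A (inv g))"
      by (rule bij_betw_same_card)
    \<comment> \<open>Both triple counts complete to \<open>l * card T\<close>, so their correction
      terms agree; as \<open>l\<close> is positive, \<open>inv g\<close> and \<open>g\<close> are
      both in \<open>T\<close> or both outside it.\<close>
    then show ?thesis
      using near_factorization_sum_translate[OF nf finST(2) g]
        near_factorization_sum_translate[OF nf finST(2) inv_closed[OF g]] g \<open>l > 0\<close>
      by (auto simp: cardA split: if_splits)
  qed
  then show ?thesis
    using sub unfolding symmetric_subset_def by blast
qed

end

theorem lemma1p9:
  fixes G :: "('a, 'b) monoid_scheme" and l :: nat and S T :: "'a set"
  assumes "group G"
    and "finite (carrier G)"
    and "l > 0"
    and "near_factorization G l S T"
  shows "(symmetric_subset G S \<longrightarrow> symmetric_subset G T) \<and>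
         (symmetric_subset G T \<longrightarrow> symmetric_subset G S)"
proof (intro conjI impI)
  interpret group G by fact
  show "symmetric_subset G T" if "symmetric_subset G S"
    using near_factorization_symmetric assms that by blast
  show "symmetric_subset G S" if T: "symmetric_subset G T"
  proof (rule symmetric_subset_if_image_inv)
    show "S \<subseteq> carrier G"
      using assms(4) unfolding near_factorization_def by blast
    \<comment> \<open>Passing to inverses moves the symmetric factor, which equals its own set of
      inverses, into first position, where \<open>near_factorization_symmetric\<close> needs
      it.\<close>
    have "near_factorization G l T (m_inv G ` S)"
      using near_factorization_inv[OF assms(4)] symmetric_subset_image_inv[OF T] by simp
    then show "symmetric_subset G (m_inv G ` S)"
      using near_factorization_symmetric assms T by blast
  qed
qed

end
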